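(* Let $d\ge 1$, let $\mathbf f$ be a $d\times d$ matrix-valued trigonometric polynomial with $\mathbf f(\theta)\ge 0$ for all $\theta$, and suppose that there exist unique $\theta_0\in[0,2\pi)$ and $\bar\jmath\in\{1,\dots,d\}$ such that $\lambda_{\bar\jmath}(\mathbf f(\theta_0))=0$ while $\lambda_j(\mathbf f(\theta))>0$ for every $(\theta,j)\ne(\theta_0,\bar\jmath)$, $\theta\in[0,2\pi)$. Let $q_{\bar\jmath}(\theta_0)$ be a unit eigenvector of $\mathbf f(\theta_0)$ with $\mathbf f(\theta_0)q_{\bar\jmath}(\theta_0)=0$. Let $\mathbf p$ be a $d\times d$ matrix-valued trigonometric polynomial such that $\mathbf p(\theta)^H\mathbf p(\theta)+\mathbf p(\theta+\pi)^H\mathbf p(\theta+\pi)>0$ for all $\theta\in[0,2\pi)$, and set $$\mathbf s(\theta)=\mathbf p(\theta)\left(\mathbf p(\theta)^H\mathbf p(\theta)+\mathbf p(\theta+\pi)^H\mathbf p(\theta+\pi)\right)^{-1}\mathbf p(\theta)^H .$$ Assume that $\mathbf p(\theta_0)q_{\bar\jmath}(\theta_0)=\lambda^{(1)}_{\bar\jmath}q_{\bar\jmath}(\theta_0)$, $\mathbf p(\theta_0+\pi)q_{\bar\jmath}(\theta_0)=0$ and $\mathbf p(\theta_0)^Hq_{\bar\jmath}(\theta_0)=\lambda^{(2)}_{\bar\jmath}q_{\bar\jmath}(\theta_0)$ with $\lambda^{(1)}_{\bar\jmath},\lambda^{(2)}_{\bar\jmath}\neq0$. If 1. $\lambda^{(1)}_{\bar\jmath}=\lambda^{(2)}_{\bar\jmath}$,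 and 2. the limit $\displaystyle\lim_{\theta\to\theta_0}\frac{|\lambda_{\bar\jmath}(\mathbf p(\theta+\pi))|^2}{\lambda_{\bar\jmath}(\mathbf f(\theta))}$ exists and is a (finite) real constant, then the limit $$\lim_{\theta\to\theta_0}\frac{1-\lambda_{\bar\jmath}(\mathbf s(\theta))}{\lambda_{\bar\jmath}(\mathbf f(\theta))}$$ exists and is a (finite) real constant.
   Context: A $d\times d$ matrix-valued trigonometric polynomial is a finite sum $\sum_j \hat{\mathbf f}_j e^{\iota j\theta}$ with $\hat{\mathbf f}_j\in\mathbb C^{d\times d}$, $\iota^2=-1$. $X^H$ is the conjugate transpose; $X\ge0$ (resp. $X>0$) means $X$ is Hermitian nonnegative (resp. positive) definite. $\lambda_1(\mathbf f(\theta)),\dots,\lambda_d(\mathbf f(\theta))$ denote the continuous eigenvalue functions of the Hermitian matrix-valued function $\mathbf f$. $\lambda_{\bar\jmath}(\mathbf s(\theta))$ denotes the continuous eigenvalue function of the Hermitian matrix-valued function $\mathbf s$ whose corresponding (continuous, normalized) eigenvector $w_{\bar\jmath}(\theta)$ satisfies $w_{\bar\jmath}(\theta)\to q_{\bar\jmath}(\theta_0)$ as $\theta\to\theta_0$. $\lambda_{\bar\jmath}(\mathbf p(\theta+\pi))$ denotes the eigenvalue function of $\mathbf p(\theta+\pi)$, near $\theta_0$, whose corresponding (continuous, normalized) eigenvector $h(\theta+\pi)$ satisfies $h(\theta+\pi)\to q_{\bar\jmath}(\theta_0)$ as $\theta\to\theta_0$. *)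

theory Defs
  imports "HOL-Analysis.Analysis"
begin

definition ctransp :: "complex^'n^'m \<Rightarrow> complex^'m^'n" where
  "ctransp A = (\<chi> i j. cnj (A $ j $ i))"

definition hermitian :: "complex^'n^'n \<Rightarrow> bool" where
  "hermitian A \<longleftrightarrow> ctransp A = A"

(* For Hermitian A the form x^H A x is real, so taking Re loses nothing. *)
definition quad_form :: "complex^'n^'n \<Rightarrow> complex^'n \<Rightarrow> real" where
  "quad_form A x = Re (\<Sum>i\<in>UNIV. cnj (x $ i) * (A *v x) $ i)"

definition nonneg_definite :: "complex^'n^'n \<Rightarrow> bool" where
  "nonneg_definite A \<longleftrightarrow> hermitian A \<and> (\<forall>x. 0 \<le> quad_form A x)"

definition pos_definite :: "complex^'n^'n \<Rightarrow> bool" where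
  "pos_definite A \<longleftrightarrow> hermitian A \<and> (\<forall>x. x \<noteq> 0 \<longrightarrow> 0 < quad_form A x)"

definition matrix_trig_poly :: "(real \<Rightarrow> complex^'n^'n) \<Rightarrow> bool" where
  "matrix_trig_poly f \<longleftrightarrow>
     (\<exists>(J :: int set) (c :: int \<Rightarrow> complex^'n^'n). finite J \<and>
        (\<forall>\<theta>. f \<theta> = (\<Sum>j\<in>J. \<chi> a b. exp (\<i> * of_int j * of_real \<theta>) * c j $ a $ b)))"

(* The functions l j, with j ranging over the d-element index type, are continuous on the whole
   line and list the eigenvalues of f \<theta> with multiplicity, for every \<theta>.  They need not be
   2 pi-periodic. *)
definition eigenvalue_functions :: "(real \<Rightarrow> complex^'n^'n) \<Rightarrow> ('n \<Rightarrow> real \<Rightarrow> real) \<Rightarrow> bool" where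
  "eigenvalue_functions f l \<longleftrightarrow>
     (\<forall>j. continuous_on UNIV (l j)) \<and>
     (\<forall>\<theta> z. det (mat z - f \<theta>) = (\<Prod>j\<in>UNIV. z - complex_of_real (l j \<theta>)))"

definition eigenpair_near ::
  "(real \<Rightarrow> complex^'n^'n) \<Rightarrow> real \<Rightarrow> (real \<Rightarrow> complex) \<Rightarrow> (real \<Rightarrow> complex^'n) \<Rightarrow> bool" where
  "eigenpair_near A t l w \<longleftrightarrow>
     (\<exists>U. open U \<and> t \<in> U \<and> continuous_on U l \<and> continuous_on U w \<and>
        (\<forall>\<theta>\<in>U. norm (w \<theta>) = 1 \<and> A \<theta> *v w \<theta> = l \<theta> *s w \<theta>))"

end

theory Submission
  imports Defs "HOL-Complex_Analysis.Complex_Singularities"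
begin

text \<open>
  Write \<open>N = p\<^sup>H p + p(\<cdot> + \<pi>)\<^sup>H p(\<cdot> + \<pi>)\<close> and \<open>u = N\<^sup>-\<^sup>1 p\<^sup>H w\<close>. The eigenvalue equation of \<open>s\<close> gives
  \<open>(1 - \<lambda>(s)) \<langle>w, p y\<rangle> = \<langle>p(\<cdot> + \<pi>) u, p(\<cdot> + \<pi>) y\<rangle>\<close> for all \<open>y\<close>. Taking \<open>y = u\<close> and \<open>y = h(\<cdot> + \<pi>)\<close>, and applying
  Cauchy--Schwarz, one gets \<open>0 \<le> 1 - \<lambda>(s) = O(|\<lambda>(p(\<cdot> + \<pi>))|\<^sup>2) = O(\<lambda>(f))\<close>. Since \<open>det f\<close> is analytic and only one
  eigenvalue vanishes at \<open>\<theta>\<^sub>0\<close>, \<open>\<lambda>(f)\<close> behaves like \<open>c (\<theta> - \<theta>\<^sub>0)\<^sup>k\<close> with \<open>c \<noteq> 0\<close>. It remains to see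
  that an eigenvalue of the analytic Hermitian family \<open>1 - s\<close> with a continuous eigenvector, if it is
  \<open>O((\<theta> - \<theta>\<^sub>0)\<^sup>k)\<close>, has a limit after division by \<open>(\<theta> - \<theta>\<^sub>0)\<^sup>k\<close>; this is an induction on \<open>k\<close> that lowers
  the order of vanishing with the help of matrix polynomials and avoids Rellich's theorem.
\<close>

section \<open>Complex matrices\<close>

definition cinner :: "complex^'n \<Rightarrow> complex^'n \<Rightarrow> complex" where
  "cinner x y = (\<Sum>i\<in>UNIV. cnj (x $ i) * y $ i)"

lemma cinner_ctransp: "cinner x (A *v y) = cinner (ctransp A *v x) y"
proof -
  have "cinner x (A *v y) = (\<Sum>i\<in>UNIV. \<Sum>j\<in>UNIV. cnj (x $ i) * (A $ i $ j * y $ j))"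
    by (simp add: cinner_def matrix_vector_mult_def sum_distrib_left)
  also have "\<dots> = (\<Sum>j\<in>UNIV. \<Sum>i\<in>UNIV. cnj (x $ i) * (A $ i $ j * y $ j))"
    by (rule sum.swap)
  also have "\<dots> = cinner (ctransp A *v x) y"
    by (simp add: cinner_def matrix_vector_mult_def ctransp_def sum_distrib_left ac_simps)
  finally show ?thesis .
qed

lemma cinner_self: "cinner x x = complex_of_real ((norm x)\<^sup>2)"
proof -
  have "(norm x)\<^sup>2 = (\<Sum>i\<in>UNIV. (cmod (x $ i))\<^sup>2)"
    by (simp add: norm_vec_def L2_set_def sum_nonneg)
  moreover have "cnj z * z = complex_of_real ((cmod z)\<^sup>2)" for z
    by (metis complex_norm_square mult.commute)
  ultimately show ?thesis
    by (simp add: cinner_def)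
qed

lemma cinner_add_right: "cinner x (y + z) = cinner x y + cinner x z"
  by (simp add: cinner_def algebra_simps sum.distrib)

lemma cinner_scale_right: "cinner x (c *s y) = c * cinner x y"
  by (simp add: cinner_def sum_distrib_left ac_simps)

lemma cinner_scale_left: "cinner (c *s x) y = cnj c * cinner x y"
  by (simp add: cinner_def sum_distrib_left ac_simps)

lemma cmod_cinner_le: "cmod (cinner x y) \<le> norm x * norm y"
proof -
  have "cmod (cinner x y) \<le> (\<Sum>i\<in>UNIV. \<bar>cmod (x $ i)\<bar> * \<bar>cmod (y $ i)\<bar>)"
    unfolding cinner_def by (rule order_trans[OF norm_sum]) (simp add: norm_mult)
  also have "\<dots> \<le> norm x * norm y"
    unfolding norm_vec_def by (rule L2_set_mult_ineq)
  finally show ?thesis .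
qed

lemma tendsto_cinner [tendsto_intros]:
  assumes "(f \<longlongrightarrow> x) F" "(g \<longlongrightarrow> y) F"
  shows "((\<lambda>t. cinner (f t) (g t)) \<longlongrightarrow> cinner x y) F"
  unfolding cinner_def by (intro tendsto_intros assms)

lemma tendsto_matrix_vector_mult:
  fixes A :: "'a \<Rightarrow> complex^'n^'m"
  assumes "(A \<longlongrightarrow> A0) F" "(v \<longlongrightarrow> v0) F"
  shows "((\<lambda>t. A t *v v t) \<longlongrightarrow> A0 *v v0) F"
  unfolding matrix_vector_mult_def
  by (intro vec_tendstoI) (auto intro!: tendsto_intros assms)

section \<open>Adjoints, Hermitian matrices and inverses\<close>

lemma ctransp_mult: "ctransp (A ** B) = ctransp B ** ctransp A"
  by (simp add: ctransp_def matrix_matrix_mult_def vec_eq_iff mult.commute)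

lemma ctransp_add: "ctransp (A + B) = ctransp A + ctransp B"
  by (simp add: ctransp_def vec_eq_iff)

lemma ctransp_ctransp [simp]: "ctransp (ctransp A) = A"
  by (simp add: ctransp_def vec_eq_iff)

lemma hermitian_mat: "hermitian (mat (complex_of_real c))"
  by (simp add: hermitian_def ctransp_def mat_def vec_eq_iff)

lemma hermitian_add: "hermitian A \<Longrightarrow> hermitian B \<Longrightarrow> hermitian (A + B)"
  by (simp add: hermitian_def ctransp_add)

lemma matrix_add_rdistrib: "(A + B) ** C = A ** C + B ** (C :: complex^'n^'m)"
  by (simp add: matrix_matrix_mult_def vec_eq_iff algebra_simps sum.distrib)

lemma hermitian_mult_mult_ctransp:
  "hermitian A \<Longrightarrow> hermitian (B ** A ** ctransp B)"
  by (simp add: hermitian_def ctransp_mult matrix_mul_assoc)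

lemma hermitian_ctransp_mult_self: "hermitian (ctransp A ** A)"
  by (simp add: hermitian_def ctransp_mult)

lemma hermitian_mat_1_diff: "hermitian A \<Longrightarrow> hermitian (mat 1 - A)"
  by (simp add: hermitian_def ctransp_def mat_def vec_eq_iff)

lemma matrix_inv_mult:
  fixes A :: "'a::semiring_1^'n^'n"
  assumes "invertible A"
  shows "A ** matrix_inv A = mat 1" "matrix_inv A ** A = mat 1"
  using someI_ex[OF assms[unfolded invertible_def]] by (auto simp: matrix_inv_def)

lemma hermitian_matrix_inv:
  fixes A :: "complex^'n^'n"
  assumes "hermitian A" "invertible A"
  shows "hermitian (matrix_inv A)"
proof -
  note matrix_inv_mult[OF assms(2)]
  moreover from this have "ctransp (matrix_inv A) ** A = mat 1"
    using assms(1) hermitian_mat[of 1] ctransp_mult[of A "matrix_inv A"]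
    unfolding hermitian_def by (metis of_real_1)
  ultimately show ?thesis
    by (metis hermitian_def matrix_mul_assoc matrix_mul_lid matrix_mul_rid)
qed

text \<open>For Hermitian \<open>A\<close> the squared norm of \<open>A B x\<close> is the inner
  product of \<open>B x\<close> with \<open>A A B x\<close>, so \<open>A\<close> and its square have
  the same kernel.\<close>

lemma hermitian_mult_self_eq_0:
  assumes "hermitian A" "A ** (A ** B) = 0"
  shows "A ** B = 0"
proof -
  have "(A ** B) *v x = 0" for x
  proof -
    have "cinner ((A ** B) *v x) ((A ** B) *v x) = cinner (B *v x) (A ** (A ** B) *v x)"
      using assms(1) by (simp add: cinner_ctransp hermitian_def flip: matrix_vector_mul_assoc)
    then show ?thesis
      using assms(2) by (simp add: cinner_self) (simp add: cinner_def)
  qed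
  then show ?thesis
    by (simp add: matrix_eq)
qed

section \<open>Polynomials evaluated at a matrix\<close>

definition mat_poly :: "real poly \<Rightarrow> complex^'n^'n \<Rightarrow> complex^'n^'n" where
  "mat_poly p A = fold_coeffs (\<lambda>c B. mat (complex_of_real c) + A ** B) p 0"

lemma mat_poly_0 [simp]: "mat_poly 0 A = 0"
  by (simp add: mat_poly_def)

lemma mat_poly_pCons: "mat_poly (pCons c p) A = mat (complex_of_real c) + A ** mat_poly p A"
proof (cases "p = 0 \<and> c = 0")
  case True
  then show ?thesis by (simp add: mat_def vec_eq_iff matrix_matrix_mult_def)
qed (auto simp: mat_poly_def)

lemma mat_poly_add: "mat_poly (p + q) A = mat_poly p A + mat_poly q A"
proof (induction p q rule: poly_induct2)
  case (pCons a p b q)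
  have "mat (complex_of_real (a + b)) = mat (complex_of_real a) + (mat (complex_of_real b) :: complex^'a^'a)"
    by (simp add: mat_def vec_eq_iff)
  then show ?case
    by (simp add: mat_poly_pCons pCons matrix_add_ldistrib)
qed simp

lemma mat_poly_smult: "mat_poly (smult c p) A = c *\<^sub>R mat_poly p A"
proof (induction p)
  case (pCons a p)
  then show ?case
    by (simp add: mat_poly_pCons vec_eq_iff mat_def matrix_matrix_mult_def scaleR_sum_right algebra_simps
        scaleR_conv_of_real[of c "complex_of_real a"])
qed simp

lemma mat_poly_sum: "mat_poly (\<Sum>i\<in>I. f i) A = (\<Sum>i\<in>I. mat_poly (f i) A)"
  by (induction I rule: infinite_finite_induct) (simp_all add: mat_poly_add)

lemma mat_poly_mult_commute: "A ** mat_poly p A = mat_poly p A ** A"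
proof (induction p)
  case (pCons a p)
  have "A ** mat (complex_of_real a) = mat (complex_of_real a) ** A"
    by (simp add: matrix_matrix_mult_def mat_def vec_eq_iff if_distrib if_distribR cong: if_cong)
  then show ?case
    by (simp add: mat_poly_pCons matrix_add_ldistrib matrix_add_rdistrib)
       (metis pCons.IH matrix_mul_assoc)
qed (simp add: matrix_matrix_mult_def vec_eq_iff)

text \<open>Real coefficients are their own conjugates, and \<open>A\<close> commutes with
  \<open>p(A)\<close>, so reversing the order of the factors changes nothing.\<close>

lemma hermitian_mat_poly:
  assumes "hermitian A"
  shows "hermitian (mat_poly p A)"
proof (induction p)
  case 0
  show ?case using hermitian_mat[of 0] by (simp add: hermitian_def ctransp_def vec_eq_iff)
next
  case (pCons a p)
  have "hermitian (A ** mat_poly p A)"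
    using assms pCons.IH mat_poly_mult_commute[of A p] by (simp add: hermitian_def ctransp_mult)
  then show ?case
    by (simp add: mat_poly_pCons hermitian_add hermitian_mat)
qed

lemma mat_poly_eigenvector:
  assumes "A *v v = complex_of_real a *s v"
  shows "mat_poly p A *v v = complex_of_real (poly p a) *s v"
proof (induction p)
  case (pCons c p)
  have "mat (complex_of_real c) *v v = complex_of_real c *s v"
    by (simp add: matrix_vector_mult_def mat_def vec_eq_iff if_distrib if_distribR cong: if_cong)
  then show ?case
    by (simp add: mat_poly_pCons matrix_vector_mult_add_rdistrib pCons.IH assms 
        vector_scalar_commute vector_smult_assoc mult.commute flip: matrix_vector_mul_assoc)
qed simp

lemma exists_linear_relation:
  fixes v :: "nat \<Rightarrow> 'a::euclidean_space"
  obtains n c where "(\<Sum>i\<le>n. c i *\<^sub>R v i) = 0" "\<exists>i\<le>n. c i \<noteq> (0::real)"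
\<comment> \<open>Dependence is a property of sets, so a repeated vector would go unnoticed in the
  image. The injective case has DIM + 1 distinct vectors; otherwise \<open>v i - v j = 0\<close> is
  the relation.\<close>
proof (cases "inj_on v {..DIM('a)}")
  case True
  have "dependent (v ` {..DIM('a)})"
    by (rule dependent_biggerset) (simp add: card_image[OF True])
  then obtain u where u: "(\<Sum>x\<in>v ` {..DIM('a)}. u x *\<^sub>R x) = 0" "\<exists>x\<in>v ` {..DIM('a)}. u x \<noteq> 0"
    by (auto simp: real_vector.dependent_finite)
  show ?thesis
    using u by (intro that[of "\<lambda>i. u (v i)" "DIM('a)"]) (auto simp: sum.reindex[OF True])
next
  case False
  then obtain i j where ij: "i \<le> DIM('a)" "j \<le> DIM('a)" "i \<noteq> j" "v i = v j"
    by (auto simp: inj_on_def)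
  have "(\<Sum>k\<le>DIM('a). ((if k = i then 1 else 0) - (if k = j then 1 else 0)) *\<^sub>R v k) = 0"
    using ij by (simp add: scaleR_left_diff_distrib sum_subtractf if_distribR if_distrib[of "\<lambda>c. c *\<^sub>R _"] cong: if_cong)
  then show ?thesis
    using ij by (intro that[of _ "DIM('a)"]) auto
qed

text \<open>The powers of \<open>A\<close> lie in a finite-dimensional real vector space and hence
  satisfy a relation over the reals. This yields real coefficients even when the characteristic
  polynomial of \<open>A\<close> is not real.\<close>

lemma exists_annihilating_poly:
  fixes A :: "complex^'n^'n"
  obtains p where "p \<noteq> 0" "mat_poly p A = 0"
proof -
  obtain n c where c: "(\<Sum>i\<le>n. c i *\<^sub>R mat_poly (monom 1 i) A) = 0" "\<exists>i\<le>n. c i \<noteq> (0::real)"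
    using exists_linear_relation[of "\<lambda>i. mat_poly (monom 1 i) A"] by metis
  define p where "p = (\<Sum>i\<le>n. smult (c i) (monom 1 i))"
  have "coeff p i = c i" if "i \<le> n" for i
    using that by (simp add: p_def coeff_sum if_distrib cong: if_cong)
  then have "p \<noteq> 0"
    using c(2) by force
  moreover have "mat_poly p A = 0"
    using c(1) by (simp add: p_def mat_poly_sum mat_poly_smult del: smult_monom)
  ultimately show ?thesis by (rule that)
qed

text \<open>A Hermitian matrix has no nilpotent part at the eigenvalue 0, so 0 can be made a simple root
  of an annihilating polynomial.\<close>
lemma hermitian_annihilating_poly:
  fixes A :: "complex^'n^'n"
  assumes "hermitian A"
  obtains p where "poly p 0 = 1" "A ** mat_poly p A = 0"
proof -
  \<comment> \<open>Factors X are stripped from \<open>p\<close> one at a time: a zero constant term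
    gives \<open>A (A p'(A)) = 0\<close>, where one \<open>A\<close> cancels. A nonzero constant
    term is normalised to 1.\<close>
  have *: "p \<noteq> 0 \<Longrightarrow> A ** mat_poly p A = 0 \<Longrightarrow> \<exists>p. poly p 0 = 1 \<and> A ** mat_poly p A = 0" for p
  proof (induction p)
    case (pCons c p)
    show ?case
    proof (cases "c = 0")
      case True
      then have "A ** (A ** mat_poly p A) = 0"
        using pCons.prems(2) by (simp add: mat_poly_pCons mat_def flip: zero_vec_def)
      then show ?thesis
        using True pCons.IH pCons.hyps hermitian_mult_self_eq_0[OF assms, of "mat_poly p A"] by auto
    next
      case False
      have "A ** (inverse c *\<^sub>R mat_poly (pCons c p) A) = inverse c *\<^sub>R (A ** mat_poly (pCons c p) A)"
        by (simp add: vec_eq_iff matrix_matrix_mult_def scaleR_sum_right)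
      then have "A ** mat_poly (smult (inverse c) (pCons c p)) A = 0"
        using pCons.prems(2) by (simp only: mat_poly_smult) simp
      then show ?thesis
        using False by (intro exI[of _ "smult (inverse c) (pCons c p)"]) simp
    qed
  qed simp
  obtain p where "p \<noteq> 0" "mat_poly p A = 0"
    by (rule exists_annihilating_poly)
  then have "\<exists>p. poly p 0 = 1 \<and> A ** mat_poly p A = 0"
    by (intro *[of p]) (simp_all add: matrix_matrix_mult_def vec_eq_iff)
  then show ?thesis using that by blast
qed

section \<open>Analytic families of matrices\<close>

text \<open>The holomorphic extension gives access to removable singularities and orders of zeros.
  The filter \<open>nhds x\<close> contains the point itself, so \<open>g x = F x\<close>.\<close>

definition real_analytic_at :: "(real \<Rightarrow> complex) \<Rightarrow> real \<Rightarrow> bool" where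
  "real_analytic_at g x \<longleftrightarrow>
     (\<exists>F. F analytic_on {complex_of_real x} \<and> (\<forall>\<^sub>F t in nhds x. g t = F (complex_of_real t)))"

lemma real_analytic_atI:
  "F analytic_on {complex_of_real x} \<Longrightarrow> (\<And>t. g t = F (complex_of_real t)) \<Longrightarrow> real_analytic_at g x"
  by (auto simp: real_analytic_at_def)

lemma real_analytic_at_cong:
  assumes "real_analytic_at g x" "\<forall>\<^sub>F t in nhds x. h t = g t"
  shows "real_analytic_at h x"
proof -
  obtain F where "F analytic_on {complex_of_real x}" "\<forall>\<^sub>F t in nhds x. g t = F (complex_of_real t)"
    using assms(1) by (auto simp: real_analytic_at_def)
  moreover from this(2) assms(2) have "\<forall>\<^sub>F t in nhds x. h t = F (complex_of_real t)"
    by eventually_elim simp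
  ultimately show ?thesis by (auto simp: real_analytic_at_def)
qed

lemma real_analytic_at_const [intro, simp]: "real_analytic_at (\<lambda>t. c) x"
  by (rule real_analytic_atI[of "\<lambda>z. c"]) auto

lemma real_analytic_at_add:
  assumes "real_analytic_at f x" "real_analytic_at g x"
  shows "real_analytic_at (\<lambda>t. f t + g t) x"
proof -
  obtain F G where FG: "F analytic_on {complex_of_real x}" "G analytic_on {complex_of_real x}"
    and ev: "\<forall>\<^sub>F t in nhds x. f t = F (complex_of_real t)" "\<forall>\<^sub>F t in nhds x. g t = G (complex_of_real t)"
    using assms by (auto simp: real_analytic_at_def)
  from ev have "\<forall>\<^sub>F t in nhds x. f t + g t = F (complex_of_real t) + G (complex_of_real t)"
    by eventually_elim simp
  with analytic_on_add[OF FG] show ?thesis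
    unfolding real_analytic_at_def by (intro exI[of _ "\<lambda>z. F z + G z"]) simp
qed

lemma real_analytic_at_mult:
  assumes "real_analytic_at f x" "real_analytic_at g x"
  shows "real_analytic_at (\<lambda>t. f t * g t) x"
proof -
  obtain F G where FG: "F analytic_on {complex_of_real x}" "G analytic_on {complex_of_real x}"
    and ev: "\<forall>\<^sub>F t in nhds x. f t = F (complex_of_real t)" "\<forall>\<^sub>F t in nhds x. g t = G (complex_of_real t)"
    using assms by (auto simp: real_analytic_at_def)
  from ev have "\<forall>\<^sub>F t in nhds x. f t * g t = F (complex_of_real t) * G (complex_of_real t)"
    by eventually_elim simp
  with analytic_on_mult[OF FG] show ?thesis
    unfolding real_analytic_at_def by (intro exI[of _ "\<lambda>z. F z * G z"]) simp
qed

lemma real_analytic_at_diff: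
  assumes "real_analytic_at f x" "real_analytic_at g x"
  shows "real_analytic_at (\<lambda>t. f t - g t) x"
  using real_analytic_at_add[OF assms(1) real_analytic_at_mult[OF real_analytic_at_const[of "-1"] assms(2)]]
  by simp

lemma real_analytic_at_inverse:
  assumes "real_analytic_at f x" "f x \<noteq> 0"
  shows "real_analytic_at (\<lambda>t. inverse (f t)) x"
proof -
  obtain F where F: "F analytic_on {complex_of_real x}" 
    and ev: "\<forall>\<^sub>F t in nhds x. f t = F (complex_of_real t)"
    using assms by (auto simp: real_analytic_at_def)
  have "F (complex_of_real x) \<noteq> 0"
    using assms(2) eventually_nhds_x_imp_x[OF ev] by simp
  then have "(\<lambda>z. inverse (F z)) analytic_on {complex_of_real x}"
    using F by (intro analytic_on_inverse) auto
  moreover from ev have "\<forall>\<^sub>F t in nhds x. inverse (f t) = inverse (F (complex_of_real t))"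
    by eventually_elim simp
  ultimately show ?thesis
    unfolding real_analytic_at_def by (intro exI[of _ "\<lambda>z. inverse (F z)"]) simp
qed

lemma real_analytic_at_sum:
  "(\<And>i. i \<in> I \<Longrightarrow> real_analytic_at (f i) x) \<Longrightarrow> real_analytic_at (\<lambda>t. \<Sum>i\<in>I. f i t) x"
  by (induction I rule: infinite_finite_induct) (auto intro: real_analytic_at_add)

lemma real_analytic_at_prod:
  "(\<And>i. i \<in> I \<Longrightarrow> real_analytic_at (f i) x) \<Longrightarrow> real_analytic_at (\<lambda>t. \<Prod>i\<in>I. f i t) x"
  by (induction I rule: infinite_finite_induct) (auto intro: real_analytic_at_mult)

lemma real_analytic_at_exp: "real_analytic_at (\<lambda>t. exp (c * complex_of_real t)) x"
  by (rule real_analytic_atI[of "\<lambda>z. exp (c * z)"]) (auto intro!: analytic_intros)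

lemma real_analytic_at_isCont:
  assumes "real_analytic_at f x"
  shows "isCont f x"
proof -
  obtain F where F: "F analytic_on {complex_of_real x}" 
    and ev: "\<forall>\<^sub>F t in nhds x. f t = F (complex_of_real t)"
    using assms by (auto simp: real_analytic_at_def)
  have "isCont (\<lambda>t. F (complex_of_real t)) x"
    by (rule isCont_o2[of _ complex_of_real F]) (simp_all add: analytic_at_imp_isCont[OF F])
  then show ?thesis
    using isCont_cong[OF ev] by simp
qed

text \<open>The singularity of \<open>F w / (w - z)\<close> at the zero \<open>z\<close> is
  removable, with value \<open>deriv F z\<close>.\<close>

lemma real_analytic_at_factor:
  assumes "real_analytic_at g x" "g x = 0"
  obtains G where "real_analytic_at G x" "\<forall>\<^sub>F t in nhds x. g t = complex_of_real (t - x) * G t"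
proof -
  obtain F where F: "F analytic_on {complex_of_real x}" 
    and ev: "\<forall>\<^sub>F t in nhds x. g t = F (complex_of_real t)"
    using assms by (auto simp: real_analytic_at_def)
  define z where "z = complex_of_real x"
  have Fz: "F z = 0"
    using assms(2) eventually_nhds_x_imp_x[OF ev] by (simp add: z_def)
  define G where "G = (\<lambda>w. if w = z then deriv F z else F w / (w - z))"
  have "G analytic_on {z}"
  proof (rule pole_theorem_analytic_0[where a = z])
    show "\<exists>d>0. \<forall>w\<in>ball y d - {z}. F w = (w - z) * G w" for y
      by (intro exI[of _ 1]) (auto simp: G_def)
  qed (use F Fz in \<open>auto simp: G_def z_def\<close>)
  then have "real_analytic_at (\<lambda>t. G (complex_of_real t)) x"
    by (intro real_analytic_atI[of G]) (auto simp: z_def)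
  moreover from ev have "\<forall>\<^sub>F t in nhds x. g t = complex_of_real (t - x) * G (complex_of_real t)"
    by eventually_elim (use Fz in \<open>auto simp: G_def z_def\<close>)
  ultimately show ?thesis by (rule that)
qed

text \<open>Nonzero values arbitrarily close to \<open>x\<close> show that \<open>F\<close> is not
  identically zero, so \<open>F\<close> is a power of \<open>w - z\<close> times a holomorphic
  factor that does not vanish; \<open>c\<close> is the value of that factor at
  \<open>z\<close>.\<close>

lemma real_analytic_at_order:
  assumes "real_analytic_at g x" "\<exists>\<^sub>F t in at x. g t \<noteq> 0"
  obtains k c where "c \<noteq> 0" "((\<lambda>t. g t / complex_of_real (t - x) ^ k) \<longlongrightarrow> c) (at x)"
proof -
  obtain F where F: "F analytic_on {complex_of_real x}" 
    and ev: "\<forall>\<^sub>F t in nhds x. g t = F (complex_of_real t)"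
    using assms by (auto simp: real_analytic_at_def)
  define z where "z = complex_of_real x"
  obtain e where e: "e > 0" "F holomorphic_on ball z e"
    using F by (auto simp: analytic_at_ball z_def)
  have "\<forall>\<^sub>F t in nhds x. t \<in> ball x e"
    using e(1) by (intro eventually_nhds_in_open) auto
  then have "\<exists>\<^sub>F t in at x. g t \<noteq> 0 \<and> g t = F (complex_of_real t) \<and> t \<in> ball x e"
    using ev assms(2) by (auto simp: eventually_at_filter elim: eventually_mono
        intro!: frequently_eventually_frequently eventually_conj)
  then obtain t where "F (complex_of_real t) \<noteq> 0" "t \<in> ball x e"
    by (auto dest!: frequently_ex)
  then have "\<exists>w\<in>ball z e. F w \<noteq> 0"
    by (intro bexI[of _ "complex_of_real t"]) (auto simp: z_def dist_of_real)
  then obtain r where r: "r > 0" "zor_poly F z holomorphic_on cball z r"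
    and eq: "\<And>w. w \<in> cball z r \<Longrightarrow> F w = zor_poly F z w * (w - z) ^ nat (zorder F z) \<and> zor_poly F z w \<noteq> 0"
    using zorder_exist_zero[of F "ball z e" z] e by (metis centre_in_ball connected_ball open_ball)
  define G k where "G = zor_poly F z" and "k = nat (zorder F z)"
  have "G analytic_on {z}"
    using r holomorphic_on_subset[of "zor_poly F z" "cball z r" "ball z r"] ball_subset_cball
    by (auto simp: analytic_at_ball G_def)
  then have "isCont (\<lambda>t. G (complex_of_real t)) x"
    by (intro real_analytic_at_isCont real_analytic_atI[of G]) (auto simp: z_def)
  moreover have "\<forall>\<^sub>F t in nhds x. t \<in> ball x r"
    using r(1) by (intro eventually_nhds_in_open) auto
  with ev have "\<forall>\<^sub>F t in nhds x. t \<noteq> x \<longrightarrow> G (complex_of_real t) = g t / complex_of_real (t - x) ^ k"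
  proof eventually_elim
    case (elim t)
    then show ?case
      using eq[of "complex_of_real t"] by (auto simp: z_def G_def k_def dist_of_real)
  qed
  then have "\<forall>\<^sub>F t in at x. G (complex_of_real t) = g t / complex_of_real (t - x) ^ k"
    by (auto simp: eventually_at_filter)
  ultimately have "((\<lambda>t. g t / complex_of_real (t - x) ^ k) \<longlongrightarrow> G z) (at x)"
    using tendsto_cong by (force simp: isCont_def z_def)
  moreover have "G z \<noteq> 0"
    using eq[of z] r(1) by (auto simp: G_def)
  ultimately show ?thesis using that by blast
qed

section \<open>Matrices with analytic entries\<close>

definition matrix_analytic_at :: "(real \<Rightarrow> complex^'n^'m) \<Rightarrow> real \<Rightarrow> bool" where
  "matrix_analytic_at A x \<longleftrightarrow> (\<forall>i j. real_analytic_at (\<lambda>t. A t $ i $ j) x)"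

lemma matrix_analytic_at_tendsto:
  "matrix_analytic_at A x \<Longrightarrow> (A \<longlongrightarrow> A x) (at x)"
  by (intro vec_tendstoI) (auto simp: matrix_analytic_at_def dest!: real_analytic_at_isCont isContD)

lemma matrix_analytic_at_const [simp]: "matrix_analytic_at (\<lambda>t. C) x"
  by (simp add: matrix_analytic_at_def)

lemma matrix_analytic_at_add:
  "matrix_analytic_at A x \<Longrightarrow> matrix_analytic_at B x \<Longrightarrow> matrix_analytic_at (\<lambda>t. A t + B t) x"
  by (simp add: matrix_analytic_at_def real_analytic_at_add)

lemma matrix_analytic_at_diff:
  "matrix_analytic_at A x \<Longrightarrow> matrix_analytic_at B x \<Longrightarrow> matrix_analytic_at (\<lambda>t. A t - B t) x"
  by (simp add: matrix_analytic_at_def real_analytic_at_diff)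

lemma matrix_analytic_at_mult:
  "matrix_analytic_at A x \<Longrightarrow> matrix_analytic_at B x \<Longrightarrow> matrix_analytic_at (\<lambda>t. A t ** B t) x"
  by (auto simp: matrix_analytic_at_def matrix_matrix_mult_def
      intro!: real_analytic_at_sum real_analytic_at_mult)

lemma matrix_analytic_at_mat_poly:
  "matrix_analytic_at A x \<Longrightarrow> matrix_analytic_at (\<lambda>t. mat_poly p (A t)) x"
  by (induction p) (simp_all add: mat_poly_pCons matrix_analytic_at_add matrix_analytic_at_mult)

lemma real_analytic_at_det:
  fixes A :: "real \<Rightarrow> complex^'n^'n"
  shows "matrix_analytic_at A x \<Longrightarrow> real_analytic_at (\<lambda>t. det (A t)) x"
  unfolding det_def
  by (intro real_analytic_at_sum real_analytic_at_mult real_analytic_at_prod real_analytic_at_const)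
     (simp add: matrix_analytic_at_def)

lemma matrix_analytic_at_eventually_invertible:
  fixes A :: "real \<Rightarrow> complex^'n^'n"
  assumes "matrix_analytic_at A x" "invertible (A x)"
  shows "\<forall>\<^sub>F t in nhds x. invertible (A t)"
proof -
  have "isCont (\<lambda>t. det (A t)) x" "det (A x) \<noteq> 0"
    using real_analytic_at_isCont[OF real_analytic_at_det[OF assms(1)]] assms(2)
    by (simp_all add: invertible_det_nz)
  then have "\<forall>\<^sub>F t in at x. det (A t) \<noteq> 0"
    using tendsto_imp_eventually_ne isContD by blast
  then show ?thesis
    using assms(2) by (simp add: invertible_det_nz eventually_nhds_conv_at)
qed

text \<open>By Cramer's rule each entry of the inverse is a quotient of two analytic
  determinants.\<close>

lemma matrix_analytic_at_inv:
  fixes A :: "real \<Rightarrow> complex^'n^'n"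
  assumes "matrix_analytic_at A x" "invertible (A x)"
  shows "matrix_analytic_at (\<lambda>t. matrix_inv (A t)) x"
  unfolding matrix_analytic_at_def
proof (intro allI)
  fix k l :: 'n
  \<comment> \<open>\<open>A t\<close> with column \<open>k\<close> replaced by the unit vector
    \<open>axis l 1\<close>.\<close>
  define C where "C t = (\<chi> i j. if j = k then axis l 1 $ i else A t $ i $ j)" for t
  have "real_analytic_at (\<lambda>t. C t $ i $ j) x" for i j
    using assms(1) by (cases "j = k") (auto simp: matrix_analytic_at_def C_def)
  then have "matrix_analytic_at C x"
    by (simp add: matrix_analytic_at_def)
  then have "real_analytic_at (\<lambda>t. det (C t) * inverse (det (A t))) x"
    using assms by (intro real_analytic_at_mult real_analytic_at_inverse real_analytic_at_det)
       (auto simp: invertible_det_nz)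
  moreover have "\<forall>\<^sub>F t in nhds x. matrix_inv (A t) $ k $ l = det (C t) * inverse (det (A t))"
    using matrix_analytic_at_eventually_invertible[OF assms]
  proof eventually_elim
    case (elim t)
    have "A t *v (matrix_inv (A t) *v axis l 1) = axis l 1"
      using matrix_inv_mult(1)[OF elim] by (simp add: matrix_vector_mul_assoc)
    then have "matrix_inv (A t) *v axis l 1 =
        (\<chi> k. det (\<chi> i j. if j = k then axis l 1 $ i else A t $ i $ j) / det (A t))"
      using cramer[of "A t"] elim by (simp add: invertible_det_nz)
    then have "(matrix_inv (A t) *v axis l 1) $ k = det (C t) / det (A t)"
      by (simp add: C_def)
    then show ?case
      by (simp add: field_simps matrix_vector_mult_def axis_def if_distrib cong: if_cong)
  qed
  ultimately show "real_analytic_at (\<lambda>t. matrix_inv (A t) $ k $ l) x"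
    by (rule real_analytic_at_cong)
qed

section \<open>Eigenvalues of analytic families\<close>

lemma of_real_smult: "complex_of_real r *s v = r *\<^sub>R v"
  by (simp add: vec_eq_iff scaleR_conv_of_real[of _ "_ :: complex"])

lemma scaleR_matrix_vector_mult: "(r *\<^sub>R A) *v v = r *\<^sub>R (A *v (v :: complex^'n))"
  by (simp add: vec_eq_iff matrix_vector_mult_def scaleR_sum_right)

text \<open>The eigenvalue is the Rayleigh quotient of its eigenvector, which depends continuously
  on both matrix and vector away from the zero vector. This is the base case of the induction on
  \<open>k\<close>.\<close>

lemma eigenvalue_convergent:
  fixes A :: "real \<Rightarrow> complex^'n^'n" and a :: "real \<Rightarrow> real"
  assumes "(A \<longlongrightarrow> A0) F" "(w \<longlongrightarrow> w0) F" "w0 \<noteq> 0"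
    and "\<forall>\<^sub>F t in F. A t *v w t = complex_of_real (a t) *s w t"
  shows "\<exists>L. (a \<longlongrightarrow> L) F"
proof -
  have "((\<lambda>t. Re (cinner (w t) (A t *v w t)) / (norm (w t))\<^sup>2) \<longlongrightarrow>
      Re (cinner w0 (A0 *v w0)) / (norm w0)\<^sup>2) F"
    using assms(3) by (intro tendsto_intros tendsto_matrix_vector_mult assms) auto
  moreover have "\<forall>\<^sub>F t in F. w t \<noteq> 0"
    using tendsto_imp_eventually_ne[OF assms(2,3)] .
  with assms(4) have "\<forall>\<^sub>F t in F. Re (cinner (w t) (A t *v w t)) / (norm (w t))\<^sup>2 = a t"
    by eventually_elim (simp add: cinner_scale_right cinner_self)
  ultimately show ?thesis
    by (blast intro: Lim_transform_eventually)
qed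

lemma hermitian_limit:
  assumes "(A \<longlongrightarrow> A0) F" "\<forall>\<^sub>F t in F. hermitian (A t)" "F \<noteq> bot"
  shows "hermitian A0"
proof -
  have "((\<lambda>t. ctransp (A t)) \<longlongrightarrow> ctransp A0) F"
    unfolding ctransp_def by (intro vec_tendstoI) (auto intro!: tendsto_intros assms)
  moreover have "\<forall>\<^sub>F t in F. ctransp (A t) = A t"
    using assms(2) by (simp add: hermitian_def)
  ultimately have "(A \<longlongrightarrow> ctransp A0) F"
    by (rule Lim_transform_eventually)
  then show ?thesis
    unfolding hermitian_def by (rule tendsto_unique[OF assms(3) _ assms(1)])
qed

text \<open>If \<open>p\<close> is a polynomial with \<open>p(0) = 1\<close> and \<open>A(x) p(A(x)) = 0\<close>, then \<open>A p(A) / (t - x)\<close> extends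
  analytically to \<open>x\<close>, and the continuous eigenvector \<open>w\<close> belongs to its eigenvalue
  \<open>a p(a) / (t - x)\<close>, which lowers the order of vanishing by one.\<close>
lemma analytic_hermitian_eigenvalue_quotient:
  fixes A :: "real \<Rightarrow> complex^'n^'n" and a :: "real \<Rightarrow> real"
  assumes "matrix_analytic_at A x" "\<forall>\<^sub>F t in at x. hermitian (A t)"
    and "\<forall>\<^sub>F t in at x. A t *v w t = complex_of_real (a t) *s w t"
    and "\<forall>\<^sub>F t in at x. \<bar>a t\<bar> \<le> K * \<bar>t - x\<bar> ^ k"
    and w: "(w \<longlongrightarrow> w0) (at x)" "w0 \<noteq> 0"
  shows "\<exists>L. ((\<lambda>t. a t / (t - x) ^ k) \<longlongrightarrow> L) (at x)"
  using assms(1-4)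
\<comment> \<open>Each step replaces \<open>A\<close>, \<open>a\<close>, \<open>K\<close> by
  \<open>B\<close>, \<open>b\<close>, \<open>2 * K\<close> and keeps the eigenvector
  \<open>w\<close>.\<close>
proof (induction k arbitrary: A a K)
  case 0
  show ?case
    using eigenvalue_convergent[OF matrix_analytic_at_tendsto[OF 0(1)] w 0(3)] by simp
next
  case (Suc k)
  have "((\<lambda>t. K * \<bar>t - x\<bar> ^ Suc k) \<longlongrightarrow> K * \<bar>x - x\<bar> ^ Suc k) (at x)"
    by (intro tendsto_intros)
  then have a0: "(a \<longlongrightarrow> 0) (at x)"
    using Lim_null_comparison[of a "\<lambda>t. K * \<bar>t - x\<bar> ^ Suc k"] Suc.prems(4) by simp
  \<comment> \<open>The hypothesis covers only the punctured neighbourhood; the limit supplies the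
    point \<open>x\<close>.\<close>
  have "hermitian (A x)"
    by (rule hermitian_limit[OF matrix_analytic_at_tendsto[OF Suc.prems(1)] Suc.prems(2)]) simp
  then obtain p where p: "poly p 0 = 1" "A x ** mat_poly p (A x) = 0"
    by (rule hermitian_annihilating_poly)
  have pa: "((\<lambda>t. poly p (a t)) \<longlongrightarrow> 1) (at x)"
    using tendsto_poly[OF a0, of p] p(1) by simp
  define R where "R t = A t ** mat_poly p (A t)" for t
  have R: "matrix_analytic_at R x"
    unfolding R_def by (intro matrix_analytic_at_mult matrix_analytic_at_mat_poly Suc.prems(1))
  have "\<exists>G. real_analytic_at G x \<and> (\<forall>\<^sub>F t in nhds x. R t $ i $ j = complex_of_real (t - x) * G t)" for i j
  proof -
    have "real_analytic_at (\<lambda>t. R t $ i $ j) x" "R x $ i $ j = 0"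
      using R p(2) by (simp_all add: matrix_analytic_at_def R_def)
    then show ?thesis
      by (rule real_analytic_at_factor) blast
  qed
  then have "\<exists>G. \<forall>i j. real_analytic_at (G i j) x \<and>
      (\<forall>\<^sub>F t in nhds x. R t $ i $ j = complex_of_real (t - x) * G i j t)"
    by (intro choice allI)
  then obtain G where G: "\<And>i j. real_analytic_at (G i j) x"
      "\<And>i j. \<forall>\<^sub>F t in nhds x. R t $ i $ j = complex_of_real (t - x) * G i j t"
    by blast
  define B where "B t = (\<chi> i j. G i j t)" for t
  define b where "b t = a t * poly p (a t) / (t - x)" for t
  have "\<forall>\<^sub>F t in nhds x. \<forall>i j. R t $ i $ j = complex_of_real (t - x) * G i j t"
    using G(2) by (intro eventually_all_finite)
  then have RB: "\<forall>\<^sub>F t in at x. R t = (t - x) *\<^sub>R B t"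
    unfolding eventually_at_filter
    by eventually_elim (simp add: vec_eq_iff B_def, simp add: scaleR_conv_of_real)
  have ne: "\<forall>\<^sub>F t in at x. t \<noteq> x"
    by (rule eventually_neq_at_within)
  have "\<exists>L. ((\<lambda>t. b t / (t - x) ^ k) \<longlongrightarrow> L) (at x)"
  proof (rule Suc.IH)
    show "matrix_analytic_at B x"
      using G(1) by (simp add: matrix_analytic_at_def B_def)
    show "\<forall>\<^sub>F t in at x. hermitian (B t)"
      using RB ne Suc.prems(2)
    proof eventually_elim
      case (elim t)
      have "hermitian (R t)"
        using elim(3) hermitian_mat_poly[OF elim(3), of p]
        by (simp add: hermitian_def R_def ctransp_mult mat_poly_mult_commute)
      then have "(t - x) *\<^sub>R ctransp (B t) = (t - x) *\<^sub>R B t"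
        by (simp add: elim(1) hermitian_def ctransp_def vec_eq_iff)
      then show ?case
        using elim(2) by (simp add: hermitian_def)
    qed
    show "\<forall>\<^sub>F t in at x. B t *v w t = complex_of_real (b t) *s w t"
      using RB ne Suc.prems(3)
    proof eventually_elim
      case (elim t)
      have "(t - x) *\<^sub>R (B t *v w t) = R t *v w t"
        by (simp add: elim(1) scaleR_matrix_vector_mult)
      also have "\<dots> = A t *v (complex_of_real (poly p (a t)) *s w t)"
        by (simp add: R_def mat_poly_eigenvector[OF elim(3)] flip: matrix_vector_mul_assoc)
      also have "\<dots> = (a t * poly p (a t)) *\<^sub>R w t"
        by (simp add: vector_scalar_commute elim(3)) (simp add: mult.commute flip: of_real_smult)
      also have "\<dots> = (t - x) *\<^sub>R (complex_of_real (b t) *s w t)"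
        using elim(2) by (simp add: b_def of_real_smult del: of_real_mult of_real_divide of_real_diff)
      finally show ?case
        using elim(2) by simp
    qed
    \<comment> \<open>As \<open>p(a)\<close> tends to 1, the bound 2 holds near \<open>x\<close>;
      hence the new constant \<open>2 * K\<close>.\<close>
    have "\<forall>\<^sub>F t in at x. \<bar>poly p (a t)\<bar> < 2"
      using order_tendstoD(2)[OF tendsto_rabs[OF pa], of 2] by simp
    then show "\<forall>\<^sub>F t in at x. \<bar>b t\<bar> \<le> (2 * K) * \<bar>t - x\<bar> ^ k"
      using Suc.prems(4) ne
    proof eventually_elim
      case (elim t)
      have "\<bar>a t\<bar> * \<bar>poly p (a t)\<bar> \<le> (K * \<bar>t - x\<bar> ^ Suc k) * 2"
        using elim by (intro mult_mono) auto
      then show ?case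
        using elim(3) by (simp add: b_def abs_mult field_simps)
    qed
  qed
  then obtain L where L: "((\<lambda>t. b t / (t - x) ^ k) \<longlongrightarrow> L) (at x)"
    by blast
  \<comment> \<open>Dividing by \<open>p(a)\<close>, which tends to 1, returns from \<open>b\<close>
    to \<open>a\<close>.\<close>
  have "((\<lambda>t. b t / (t - x) ^ k / poly p (a t)) \<longlongrightarrow> L / 1) (at x)"
    by (intro tendsto_intros L pa) simp
  moreover have "\<forall>\<^sub>F t in at x. poly p (a t) \<noteq> 0"
    using tendsto_imp_eventually_ne[OF pa, of 0] by simp
  then have "\<forall>\<^sub>F t in at x. b t / (t - x) ^ k / poly p (a t) = a t / (t - x) ^ Suc k"
    by eventually_elim (simp add: b_def)
  ultimately show ?case
    by (blast intro: Lim_transform_eventually)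
qed

section \<open>The pointwise bound on 1 - \<lambda>(s)\<close>

text \<open>Here \<open>P\<close> and \<open>Q\<close> stand for \<open>p\<close> at \<theta> and at
  \<theta> + pi. The eigenvector equation becomes \<open>P u = l w\<close> with \<open>N u\<close>
  equal to the adjoint of \<open>P\<close> applied to \<open>w\<close>. Testing with
  \<open>u\<close> measures \<open>Q u\<close>; testing with \<open>h\<close> brings in
  \<open>m\<close>.\<close>

lemma coarse_grid_eigenvalue_bound:
  fixes P Q :: "complex^'n^'n"
  defines "N \<equiv> ctransp P ** P + ctransp Q ** Q"
  assumes N: "invertible N"
    and w: "(P ** matrix_inv N ** ctransp P) *v w = complex_of_real l *s w" "norm w = 1"
    and h: "Q *v h = m *s h" "norm h = 1"
    and l: "l > 0"
  shows "0 \<le> 1 - l" "(1 - l) * (cmod (cinner w (P *v h)))\<^sup>2 \<le> l * (cmod m)\<^sup>2"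
proof -
  define u where "u = matrix_inv N *v (ctransp P *v w)"
  have Pu: "P *v u = complex_of_real l *s w"
    using w(1) by (simp add: u_def matrix_vector_mul_assoc matrix_mul_assoc)
  have Nu: "N *v u = ctransp P *v w"
    using matrix_inv_mult(1)[OF N] by (simp add: u_def matrix_vector_mul_assoc matrix_mul_assoc)
  \<comment> \<open>The inner product of \<open>u\<close> with \<open>N y\<close> splits into a
    \<open>P\<close> part and a \<open>Q\<close> part; as \<open>P u = l w\<close>, the
    \<open>P\<close> part is \<open>l\<close> times the left-hand inner product.\<close>
  have *: "complex_of_real (1 - l) * cinner w (P *v y) = cinner (Q *v u) (Q *v y)" for y
  proof -
    have "ctransp N = N"
      by (simp add: N_def ctransp_add ctransp_mult)
    then have "cinner w (P *v y) = cinner u (N *v y)"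
      using Nu by (simp add: cinner_ctransp)
    also have "\<dots> = cinner (P *v u) (P *v y) + cinner (Q *v u) (Q *v y)"
      by (simp add: N_def matrix_vector_mult_add_rdistrib cinner_add_right 
          cinner_ctransp[of u] flip: matrix_vector_mul_assoc)
    finally show ?thesis
      by (simp add: Pu cinner_scale_left algebra_simps)
  qed
  have "complex_of_real ((1 - l) * l) = complex_of_real ((norm (Q *v u))\<^sup>2)"
    using *[of u] w(2) by (simp add: Pu cinner_scale_right cinner_self)
  then have Qu: "(1 - l) * l = (norm (Q *v u))\<^sup>2"
    by (simp only: of_real_eq_iff)
  then show nonneg: "0 \<le> 1 - l"
    using l by (smt (verit) mult_neg_pos zero_le_power2)
  show "(1 - l) * (cmod (cinner w (P *v h)))\<^sup>2 \<le> l * (cmod m)\<^sup>2"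
  proof (cases "l = 1")
    case False
    have "cmod (complex_of_real (1 - l) * cinner w (P *v h)) \<le> cmod m * norm (Q *v u)"
      using cmod_cinner_le[of "Q *v u" h] h
      by (simp add: * cinner_scale_right norm_mult mult_left_mono del: of_real_diff)
    \<comment> \<open>By \<open>Qu\<close> the squared norm of \<open>Q u\<close> is
      \<open>(1 - l) * l\<close>, so both sides contain the factor \<open>1 - l\<close>, which is
      cancelled for \<open>l \<noteq> 1\<close>.\<close>
    then have "(cmod (complex_of_real (1 - l) * cinner w (P *v h)))\<^sup>2 \<le> (cmod m)\<^sup>2 * ((1 - l) * l)"
      unfolding Qu power_mult_distrib[symmetric] by (intro power_mono) auto
    then have "(1 - l) * ((1 - l) * (cmod (cinner w (P *v h)))\<^sup>2) \<le> (1 - l) * (l * (cmod m)\<^sup>2)"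
      by (simp only: norm_mult norm_of_real power_mult_distrib power2_abs) (simp only: power2_eq_square ac_simps)
    then show ?thesis
      using nonneg False by (simp add: mult_le_cancel_left)
  qed simp
qed

section \<open>Trigonometric polynomials and the order of the vanishing eigenvalue\<close>

text \<open>A shift multiplies the coefficients by constants. For real \<theta> conjugation only
  reverses the sign of the frequencies, so the adjoint also has entries with a holomorphic
  extension.\<close>

lemma matrix_trig_poly_analytic:
  assumes "matrix_trig_poly p"
  shows "matrix_analytic_at (\<lambda>\<theta>. p (\<theta> + a)) x" "matrix_analytic_at (\<lambda>\<theta>. ctransp (p (\<theta> + a))) x"
proof -
  obtain J c where p: "\<And>\<theta>. p \<theta> = (\<Sum>j\<in>J. \<chi> a b. exp (\<i> * of_int j * of_real \<theta>) * c j $ a $ b)"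
    using assms by (auto simp: matrix_trig_poly_def)
  have "p (\<theta> + a) $ k $ l = (\<Sum>j\<in>J. exp (\<i> * of_int j * of_real \<theta>) * (exp (\<i> * of_int j * of_real a) * c j $ k $ l))"
    for \<theta> k l
    by (simp add: p algebra_simps exp_add)
  moreover from this have "ctransp (p (\<theta> + a)) $ k $ l =
      (\<Sum>j\<in>J. exp (- \<i> * of_int j * of_real \<theta>) * cnj (exp (\<i> * of_int j * of_real a) * c j $ l $ k))"
    for \<theta> k l
    by (simp add: ctransp_def exp_cnj)
  ultimately show "matrix_analytic_at (\<lambda>\<theta>. p (\<theta> + a)) x" "matrix_analytic_at (\<lambda>\<theta>. ctransp (p (\<theta> + a))) x"
    unfolding matrix_analytic_at_def
    by (simp_all only:) (intro allI real_analytic_at_sum real_analytic_at_mult real_analytic_at_exp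
        real_analytic_at_const)+
qed

lemma pos_definite_invertible:
  fixes A :: "complex^'n^'n"
  assumes "pos_definite A"
  shows "invertible A"
proof -
  have "x = 0" if "A *v x = 0" for x
    using assms that by (auto simp: pos_definite_def quad_form_def)
  then show ?thesis
    by (simp add: invertible_left_inverse matrix_left_invertible_ker)
qed

text \<open>Up to sign, \<open>det (f t)\<close> is the product of the eigenvalues. All factors
  except \<open>l j\<close> stay away from zero near \<open>x\<close>, so the merely continuous
  \<open>l j\<close> inherits the order of the analytic determinant.\<close>

lemma eigenvalue_order:
  fixes f :: "real \<Rightarrow> complex^'n^'n"
  assumes f: "matrix_analytic_at f x" and l: "eigenvalue_functions f l"
    and nz: "\<And>i. i \<noteq> j \<Longrightarrow> l i x \<noteq> 0" "\<exists>\<^sub>F t in at x. \<forall>i. l i t \<noteq> 0"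
  obtains k c where "c \<noteq> 0" "((\<lambda>t. l j t / (t - x) ^ k) \<longlongrightarrow> c) (at x)"
proof -
  define g where "g t = det (mat 0 - f t)" for t
  have g: "g t = (\<Prod>i\<in>UNIV. - complex_of_real (l i t))" for t
  proof -
    have "det (mat 0 - f t) = (\<Prod>i\<in>UNIV. 0 - complex_of_real (l i t))"
      using l unfolding eigenvalue_functions_def by blast
    then show ?thesis
      by (simp only: g_def diff_0)
  qed
  have "real_analytic_at g x"
    unfolding g_def by (intro real_analytic_at_det matrix_analytic_at_diff f) simp
  moreover have "\<exists>\<^sub>F t in at x. g t \<noteq> 0"
    using nz(2) by (rule frequently_elim1) (simp add: g)
  ultimately obtain k c where c: "c \<noteq> 0" "((\<lambda>t. g t / complex_of_real (t - x) ^ k) \<longlongrightarrow> c) (at x)"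
    by (rule real_analytic_at_order)
  define Q where "Q t = (\<Prod>i\<in>UNIV - {j}. - complex_of_real (l i t))" for t
  have gQ: "g t = - complex_of_real (l j t) * Q t" for t
    unfolding g Q_def by (subst prod.remove[of _ j]) auto
  have "(l i \<longlongrightarrow> l i x) (at x)" for i
    using l by (auto simp: eigenvalue_functions_def continuous_on_eq_continuous_at isCont_def)
  then have "(Q \<longlongrightarrow> Q x) (at x)"
    unfolding Q_def by (intro tendsto_intros)
  moreover have "Q x \<noteq> 0"
    using nz(1) by (simp add: Q_def)
  ultimately have Q: "(Q \<longlongrightarrow> Q x) (at x)" "Q x \<noteq> 0"
    by blast+
  have "((\<lambda>t. - (g t / complex_of_real (t - x) ^ k) / Q t) \<longlongrightarrow> - c / Q x) (at x)"
    by (intro tendsto_divide tendsto_minus c Q)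
  moreover have "\<forall>\<^sub>F t in at x. Q t \<noteq> 0"
    by (rule tendsto_imp_eventually_ne[OF Q])
  then have "\<forall>\<^sub>F t in at x. - (g t / complex_of_real (t - x) ^ k) / Q t = complex_of_real (l j t / (t - x) ^ k)"
    by eventually_elim (simp add: gQ)
  ultimately have lim: "((\<lambda>t. complex_of_real (l j t / (t - x) ^ k)) \<longlongrightarrow> - c / Q x) (at x)"
    by (rule Lim_transform_eventually)
  from tendsto_Re[OF lim] have re: "((\<lambda>t. l j t / (t - x) ^ k) \<longlongrightarrow> Re (- c / Q x)) (at x)"
    by (simp del: of_real_divide)
  \<comment> \<open>A limit of real values is real, so its real part is nonzero along with
    it.\<close>
  then have "complex_of_real (Re (- c / Q x)) = - c / Q x"
    by (intro tendsto_unique[OF _ tendsto_of_real[OF re] lim]) simp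
  then have "Re (- c / Q x) \<noteq> 0"
    using c(1) Q(2) by (metis divide_eq_0_iff neg_equal_0_iff_equal of_real_0)
  then show ?thesis
    using re by (rule that)
qed

section \<open>The limit of the quotient of 1 - \<lambda>(s) and \<lambda>(f)\<close>

theorem lemma4p6:
  fixes f p s :: "real \<Rightarrow> complex^'d^'d"
    and lf :: "'d \<Rightarrow> real \<Rightarrow> real" and jbar :: 'd
    and \<theta>0 :: real and q :: "complex^'d"
    and l1 l2 :: complex
    and ls :: "real \<Rightarrow> real" and w :: "real \<Rightarrow> complex^'d"
    and lp :: "real \<Rightarrow> complex" and h :: "real \<Rightarrow> complex^'d"
  assumes f_poly: "matrix_trig_poly f"
    and f_nonneg: "\<forall>\<theta>. nonneg_definite (f \<theta>)"
    and f_eigenvalues: "eigenvalue_functions f lf"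
    and \<theta>0: "\<theta>0 \<in> {0..<2 * pi}"
    and f_zero: "lf jbar \<theta>0 = 0"
    and f_pos: "\<forall>\<theta>\<in>{0..<2 * pi}. \<forall>j. (\<theta>, j) \<noteq> (\<theta>0, jbar) \<longrightarrow> lf j \<theta> > 0"
    and q_unit: "norm q = 1"
    and q_kernel: "f \<theta>0 *v q = 0"
    and p_poly: "matrix_trig_poly p"
    and p_pos: "\<forall>\<theta>\<in>{0..<2 * pi}.
          pos_definite (ctransp (p \<theta>) ** p \<theta> + ctransp (p (\<theta> + pi)) ** p (\<theta> + pi))"
    and s_eq: "\<forall>\<theta>. s \<theta> = p \<theta> **
          matrix_inv (ctransp (p \<theta>) ** p \<theta> + ctransp (p (\<theta> + pi)) ** p (\<theta> + pi)) **
          ctransp (p \<theta>)"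
    and p_q: "p \<theta>0 *v q = l1 *s q"
    and p_shift_q: "p (\<theta>0 + pi) *v q = 0"
    and p_adj_q: "ctransp (p \<theta>0) *v q = l2 *s q"
    and l1_nz: "l1 \<noteq> 0" and l2_nz: "l2 \<noteq> 0"
    and s_eigenpair: "eigenpair_near s \<theta>0 (\<lambda>\<theta>. complex_of_real (ls \<theta>)) w"
    and w_lim: "(w \<longlongrightarrow> q) (at \<theta>0)"
    and p_eigenpair: "eigenpair_near p (\<theta>0 + pi) lp h"
    and h_lim: "((\<lambda>\<theta>. h (\<theta> + pi)) \<longlongrightarrow> q) (at \<theta>0)"
    and cond1: "l1 = l2"
    and cond2: "\<exists>L::real. ((\<lambda>\<theta>. (cmod (lp (\<theta> + pi)))\<^sup>2 / lf jbar \<theta>) \<longlongrightarrow> L) (at \<theta>0)"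
  shows "\<exists>L::real. ((\<lambda>\<theta>. (1 - ls \<theta>) / lf jbar \<theta>) \<longlongrightarrow> L) (at \<theta>0)"
proof -
  define N where "N \<theta> = ctransp (p \<theta>) ** p \<theta> + ctransp (p (\<theta> + pi)) ** p (\<theta> + pi)" for \<theta>
  have s: "s = (\<lambda>\<theta>. p \<theta> ** matrix_inv (N \<theta>) ** ctransp (p \<theta>))"
    using s_eq by (simp add: N_def fun_eq_iff)
  have p_ana: "matrix_analytic_at p \<theta>0" "matrix_analytic_at (\<lambda>\<theta>. ctransp (p \<theta>)) \<theta>0"
    using matrix_trig_poly_analytic[OF p_poly, of 0 \<theta>0] by simp_all
  have N_ana: "matrix_analytic_at N \<theta>0"
    unfolding N_def
    by (intro matrix_analytic_at_add matrix_analytic_at_mult p_ana matrix_trig_poly_analytic p_poly)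
  have N_inv0: "invertible (N \<theta>0)"
    using p_pos \<theta>0 by (intro pos_definite_invertible) (simp add: N_def)
  \<comment> \<open>For \<open>\<theta>0 = 0\<close> the interval in \<open>p_pos\<close> is not a
    neighbourhood of \<theta>0; invertibility nearby comes from continuity of the
    determinant.\<close>
  have N_inv: "\<forall>\<^sub>F \<theta> in at \<theta>0. invertible (N \<theta>)"
    using matrix_analytic_at_eventually_invertible[OF N_ana N_inv0] by (simp add: eventually_nhds_conv_at)

  obtain U where U: "open U" "\<theta>0 \<in> U" "continuous_on U (\<lambda>\<theta>. complex_of_real (ls \<theta>))" "continuous_on U w"
    and Us: "\<And>\<theta>. \<theta> \<in> U \<Longrightarrow> norm (w \<theta>) = 1 \<and> s \<theta> *v w \<theta> = complex_of_real (ls \<theta>) *s w \<theta>"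
    using s_eigenpair unfolding eigenpair_near_def by blast
  have w_ev: "\<forall>\<^sub>F \<theta> in at \<theta>0. norm (w \<theta>) = 1 \<and> s \<theta> *v w \<theta> = complex_of_real (ls \<theta>) *s w \<theta>"
    using eventually_at_in_open'[OF U(1,2)] by eventually_elim (rule Us)
  obtain V where V: "open V" "\<theta>0 + pi \<in> V"
    and Vp: "\<And>\<theta>. \<theta> \<in> V \<Longrightarrow> norm (h \<theta>) = 1 \<and> p \<theta> *v h \<theta> = lp \<theta> *s h \<theta>"
    using p_eigenpair unfolding eigenpair_near_def by blast
  have "((\<lambda>\<theta>. \<theta> + pi) \<longlongrightarrow> \<theta>0 + pi) (at \<theta>0)"
    by (intro tendsto_intros)
  from topological_tendstoD[OF this V]
  have h_ev: "\<forall>\<^sub>F \<theta> in at \<theta>0. norm (h (\<theta> + pi)) = 1 \<and> p (\<theta> + pi) *v h (\<theta> + pi) = lp (\<theta> + pi) *s h (\<theta> + pi)"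
    by eventually_elim (rule Vp)

  have "w \<theta>0 = q"
    using U by (intro tendsto_unique[OF _ _ w_lim])
      (simp_all add: continuous_on_eq_continuous_at isCont_def)
  \<comment> \<open>Since \<open>p (\<theta>0 + pi)\<close> kills \<open>q\<close>,
    \<open>N \<theta>0\<close> acts on \<open>q\<close> as \<open>l1 * l2\<close>, exactly the
    factor contributed by \<open>p\<close> and its adjoint in \<open>s\<close>. Hence
    \<open>ls \<theta>0 = 1\<close>.\<close>
  moreover have "s \<theta>0 *v q = q"
  proof -
    have "N \<theta>0 *v q = (l1 * l2) *s q"
      by (simp add: N_def matrix_vector_mult_add_rdistrib p_q p_shift_q p_adj_q vector_scalar_commute
          vector_smult_assoc flip: matrix_vector_mul_assoc)
    then have "q = (l1 * l2) *s (matrix_inv (N \<theta>0) *v q)"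
      using matrix_inv_mult(2)[OF N_inv0]
      by (metis matrix_vector_mul_assoc matrix_vector_mul_lid vector_scalar_commute)
    then have "inverse (l1 * l2) *s q = inverse (l1 * l2) *s ((l1 * l2) *s (matrix_inv (N \<theta>0) *v q))"
      by simp
    also have "\<dots> = matrix_inv (N \<theta>0) *v q"
      using l1_nz l2_nz by (simp add: vector_smult_assoc del: inverse_mult_distrib)
    finally have "matrix_inv (N \<theta>0) *v q = inverse (l1 * l2) *s q" ..
    moreover have "l2 * (inverse l1 * inverse l2 * l1) = 1"
      using l1_nz l2_nz by (simp add: field_simps)
    ultimately show ?thesis
      by (simp add: s p_adj_q p_q vector_scalar_commute
          vector_smult_assoc flip: matrix_vector_mul_assoc)
  qed
  ultimately have "q = complex_of_real (ls \<theta>0) *s q"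
    using Us[OF U(2)] by simp
  then have "cinner q q = complex_of_real (ls \<theta>0) * cinner q q"
    by (metis cinner_scale_right)
  then have "ls \<theta>0 = 1"
    using q_unit by (simp add: cinner_self)
  moreover have "(ls \<longlongrightarrow> ls \<theta>0) (at \<theta>0)"
    using U by (simp add: continuous_on_eq_continuous_at isCont_def)
  ultimately have ls_lim: "(ls \<longlongrightarrow> 1) (at \<theta>0)"
    by simp

  \<comment> \<open>The factor in front of \<open>1 - ls\<close> in the pointwise bound tends to the
    squared modulus of \<open>l1\<close>, so half of that is a positive lower bound near
    \<theta>0.\<close>
  have "((\<lambda>\<theta>. (cmod (cinner (w \<theta>) (p \<theta> *v h (\<theta> + pi))))\<^sup>2) \<longlongrightarrow> (cmod (cinner q (p \<theta>0 *v q)))\<^sup>2) (at \<theta>0)"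
    by (intro tendsto_intros tendsto_matrix_vector_mult matrix_analytic_at_tendsto p_ana w_lim h_lim)
  then have "((\<lambda>\<theta>. (cmod (cinner (w \<theta>) (p \<theta> *v h (\<theta> + pi))))\<^sup>2) \<longlongrightarrow> (cmod l1)\<^sup>2) (at \<theta>0)"
    using q_unit by (simp add: p_q cinner_scale_right cinner_self)
  then have overlap: "\<forall>\<^sub>F \<theta> in at \<theta>0. (cmod l1)\<^sup>2 / 2 < (cmod (cinner (w \<theta>) (p \<theta> *v h (\<theta> + pi))))\<^sup>2"
    using l1_nz by (intro order_tendstoD(1)) auto

  \<comment> \<open>Points just right of \<theta>0 remain in the interval where \<open>f_pos\<close>
    applies, while points to the left may leave it. One side is enough for a frequently
    statement.\<close>
  have "\<forall>\<^sub>F \<theta> in at_right \<theta>0. \<theta> \<in> {\<theta>0<..<2 * pi}"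
    using \<theta>0 by (intro eventually_at_right_real) auto
  moreover have "lf j \<theta> \<noteq> 0" if "\<theta> \<in> {\<theta>0<..<2 * pi}" for \<theta> j
  proof -
    have "\<theta> \<in> {0..<2 * pi}" "(\<theta>, j) \<noteq> (\<theta>0, jbar)"
      using that \<theta>0 by auto
    then have "lf j \<theta> > 0"
      using f_pos by blast
    then show ?thesis
      by simp
  qed
  ultimately have "\<forall>\<^sub>F \<theta> in at_right \<theta>0. \<forall>j. lf j \<theta> \<noteq> 0"
    by (blast intro: eventually_mono)
  then have "\<exists>\<^sub>F \<theta> in at_right \<theta>0. \<forall>j. lf j \<theta> \<noteq> 0"
    by (intro eventually_frequently) auto
  then have freq: "\<exists>\<^sub>F \<theta> in at \<theta>0. \<forall>j. lf j \<theta> \<noteq> 0"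
    unfolding frequently_def using filter_leD[OF at_le[of "{\<theta>0<..}" UNIV \<theta>0]] by blast
  have simple: "lf i \<theta>0 \<noteq> 0" if "i \<noteq> jbar" for i
    using bspec[OF f_pos \<theta>0, THEN spec[of _ i]] that by simp
  have "matrix_analytic_at f \<theta>0"
    using matrix_trig_poly_analytic(1)[OF f_poly, of 0 \<theta>0] by simp
  then obtain k c where c: "c \<noteq> 0" "((\<lambda>\<theta>. lf jbar \<theta> / (\<theta> - \<theta>0) ^ k) \<longlongrightarrow> c) (at \<theta>0)"
    by (rule eigenvalue_order[OF _ f_eigenvalues simple freq])
  have lf_nz: "\<forall>\<^sub>F \<theta> in at \<theta>0. lf jbar \<theta> / (\<theta> - \<theta>0) ^ k \<noteq> 0"
    by (rule tendsto_imp_eventually_ne[OF c(2,1)])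
  have lf_bound: "\<forall>\<^sub>F \<theta> in at \<theta>0. \<bar>lf jbar \<theta> / (\<theta> - \<theta>0) ^ k\<bar> < \<bar>c\<bar> + 1"
    by (rule order_tendstoD(2)[OF tendsto_rabs[OF c(2)]]) simp

  obtain M where "((\<lambda>\<theta>. (cmod (lp (\<theta> + pi)))\<^sup>2 / lf jbar \<theta>) \<longlongrightarrow> M) (at \<theta>0)"
    using cond2 by blast
  then have lp_bound: "\<forall>\<^sub>F \<theta> in at \<theta>0. \<bar>(cmod (lp (\<theta> + pi)))\<^sup>2 / lf jbar \<theta>\<bar> < \<bar>M\<bar> + 1"
    by (intro order_tendstoD(2)[OF tendsto_rabs]) auto

  \<comment> \<open>The factor 4 combines \<open>ls < 2\<close> with the halved lower bound on the
    overlap; the other two factors bound \<open>|lp|^2 / lf\<close> and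
    \<open>|lf| / |\<theta> - \<theta>0|^k\<close>.\<close>
  define K where "K = 4 / (cmod l1)\<^sup>2 * ((\<bar>M\<bar> + 1) * (\<bar>c\<bar> + 1))"
  have "\<forall>\<^sub>F \<theta> in at \<theta>0. ls \<theta> > 0" "\<forall>\<^sub>F \<theta> in at \<theta>0. ls \<theta> < 2"
    by (rule order_tendstoD[OF ls_lim]; simp)+
  then have bound: "\<forall>\<^sub>F \<theta> in at \<theta>0. \<bar>1 - ls \<theta>\<bar> \<le> K * \<bar>\<theta> - \<theta>0\<bar> ^ k"
    using N_inv w_ev h_ev overlap lf_nz lf_bound lp_bound
  proof eventually_elim
    case (elim \<theta>)
    let ?C = "(cmod (cinner (w \<theta>) (p \<theta> *v h (\<theta> + pi))))\<^sup>2" and ?m = "(cmod (lp (\<theta> + pi)))\<^sup>2"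
    have b: "0 \<le> 1 - ls \<theta>" "(1 - ls \<theta>) * ?C \<le> ls \<theta> * ?m"
      using coarse_grid_eigenvalue_bound[of "p \<theta>" "p (\<theta> + pi)" "w \<theta>" "ls \<theta>" "h (\<theta> + pi)" "lp (\<theta> + pi)"] elim
      by (auto simp: N_def s)
    \<comment> \<open>Here \<open>lf_nz\<close> matters: a zero denominator would make the quotient
      in \<open>lp_bound\<close> 0 by default and leave \<open>?m\<close> unbounded.\<close>
    have "?m \<le> (\<bar>M\<bar> + 1) * \<bar>lf jbar \<theta>\<bar>"
      using elim by (simp add: abs_mult field_simps)
    also have "\<dots> \<le> (\<bar>M\<bar> + 1) * ((\<bar>c\<bar> + 1) * \<bar>\<theta> - \<theta>0\<bar> ^ k)"
      using elim by (intro mult_left_mono) (auto simp: abs_mult power_abs field_simps)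
    finally have m: "?m \<le> (\<bar>M\<bar> + 1) * (\<bar>c\<bar> + 1) * \<bar>\<theta> - \<theta>0\<bar> ^ k"
      by (simp only: mult.assoc)
    have "(1 - ls \<theta>) * ((cmod l1)\<^sup>2 / 2) \<le> (1 - ls \<theta>) * ?C"
      using b elim by (intro mult_left_mono) auto
    also have "\<dots> \<le> 2 * ?m"
      using b(2) elim mult_right_mono[of "ls \<theta>" 2 ?m] by simp
    finally have "1 - ls \<theta> \<le> 4 / (cmod l1)\<^sup>2 * ?m"
      using l1_nz by (simp add: field_simps)
    also have "\<dots> \<le> 4 / (cmod l1)\<^sup>2 * ((\<bar>M\<bar> + 1) * (\<bar>c\<bar> + 1) * \<bar>\<theta> - \<theta>0\<bar> ^ k)"
      by (intro mult_left_mono m) simp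
    finally show ?case
      using b(1) by (simp only: K_def mult.assoc abs_of_nonneg)
  qed
  have ana: "matrix_analytic_at (\<lambda>\<theta>. mat 1 - s \<theta>) \<theta>0"
    unfolding s by (intro matrix_analytic_at_diff matrix_analytic_at_const matrix_analytic_at_mult
        matrix_analytic_at_inv p_ana N_ana N_inv0)
  \<comment> \<open>Restricted to points where \<open>N\<close> is invertible, as
    \<open>matrix_inv\<close> is an arbitrary choice elsewhere.\<close>
  have herm: "\<forall>\<^sub>F \<theta> in at \<theta>0. hermitian (mat 1 - s \<theta>)"
    using N_inv unfolding s
  proof eventually_elim
    case (elim \<theta>)
    have "hermitian (N \<theta>)"
      unfolding N_def by (intro hermitian_add hermitian_ctransp_mult_self)
    then show ?case
      by (intro hermitian_mat_1_diff hermitian_mult_mult_ctransp hermitian_matrix_inv elim)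
  qed
  have eig: "\<forall>\<^sub>F \<theta> in at \<theta>0. (mat 1 - s \<theta>) *v w \<theta> = complex_of_real (1 - ls \<theta>) *s w \<theta>"
    using w_ev by eventually_elim (simp add: matrix_vector_mult_diff_rdistrib vector_sub_rdistrib)
  have "q \<noteq> 0"
    using q_unit by auto
  then obtain L where L: "((\<lambda>\<theta>. (1 - ls \<theta>) / (\<theta> - \<theta>0) ^ k) \<longlongrightarrow> L) (at \<theta>0)"
    using analytic_hermitian_eigenvalue_quotient[OF ana herm eig bound w_lim] by blast
  \<comment> \<open>Numerator and denominator are compared with the same power, and
    \<open>c \<noteq> 0\<close> permits division of the limits.\<close>
  have "((\<lambda>\<theta>. ((1 - ls \<theta>) / (\<theta> - \<theta>0) ^ k) / (lf jbar \<theta> / (\<theta> - \<theta>0) ^ k)) \<longlongrightarrow> L / c) (at \<theta>0)"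
    by (intro tendsto_divide L c)
  moreover have "\<forall>\<^sub>F \<theta> in at \<theta>0. ((1 - ls \<theta>) / (\<theta> - \<theta>0) ^ k) / (lf jbar \<theta> / (\<theta> - \<theta>0) ^ k) =
      (1 - ls \<theta>) / lf jbar \<theta>"
    using lf_nz by eventually_elim auto
  ultimately show ?thesis
    by (blast intro: Lim_transform_eventually)
qed

end
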